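(* Let $n\ge 1$ and let $X,X^1,\dots,X^n$ be quasimartingales with $|X|\le|X^1+\dots+X^n|$. Then there exist $n$ quasimartingales $Y^1,\dots,Y^n$ such that $|Y^k|\le|X^k|$ for each $1\le k\le n$ and $X=Y^1+\dots+Y^n$. In particular, if $X$ is nonnegative, then $Y^1,\dots,Y^n$ can be chosen to be nonnegative.
   Context: All processes are real-valued, indexed by $t\in[0,\infty)$, defined on a fixed filtered probability space $(\Omega,\mathcal{F},(\mathcal{F}_t)_{t\ge 0},P)$ whose filtration satisfies the usual conditions, and c\`adl\`ag (right-continuous with left-hand limits). For processes $X,Y$, write $X\le Y$ if for every $t\ge 0$ one has $X_t\le Y_t$ almost surely; processes $X,Y$ with $X_t=Y_t$ almost surely for every $t$ are identified. $|X|$ denotes the process $|X|_t=|X_t|$. The variation of a process $X$ is $$\mathrm{Var}(X)=\sup_{\pi}\left[\sum_{i=0}^{n-1}E\big[\,|X_{t_i}-E[X_{t_{i+1}}\mid\mathcal{F}_{t_i}]|\,\big]+E|X_{t_n}|\right],$$ where the supremum is over all finite partitions $\pi: 0=t_0<t_1<\dots<t_n<\infty$. A quasimartingale is an adapted process $X$ such that $X_t$ is integrable for all $t\ge0$ and $\mathrm{Var}(X)<\infty$. *)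

theory Defs
  imports "HOL-Probability.Probability"
begin

text \<open>Time runs through the nonnegative reals. A process is a function
  \<open>real \<Rightarrow> 'a \<Rightarrow> real\<close> of which only the values at times \<open>t \<ge> 0\<close> and at points of
  \<open>space M\<close> matter; likewise a filtration is only constrained at times \<open>t \<ge> 0\<close> (the library's
  \<open>filtration\<close> locale is indexed by a whole type and cannot express this).\<close>

locale usual_filtered_prob_space = prob_space M + complete_measure M
  for M :: "'a measure" +
  fixes F :: "real \<Rightarrow> 'a measure"
  assumes subalgebra_F: "\<And>t. 0 \<le> t \<Longrightarrow> subalgebra M (F t)"
    and sets_F_mono: "\<And>s t. 0 \<le> s \<Longrightarrow> s \<le> t \<Longrightarrow> sets (F s) \<subseteq> sets (F t)"
    and right_continuous_F: "\<And>t. 0 \<le> t \<Longrightarrow> sets (F t) = (\<Inter>s\<in>{t<..}. sets (F s))"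
    and null_sets_F: "null_sets M \<subseteq> sets (F 0)"

definition cadlag :: "(real \<Rightarrow> real) \<Rightarrow> bool" where
  "cadlag f \<longleftrightarrow>
     (\<forall>t\<ge>0. continuous (at_right t) f) \<and>
     (\<forall>t>0. \<exists>l. (f \<longlongrightarrow> l) (at_left t))"

definition proc_le :: "'a measure \<Rightarrow> (real \<Rightarrow> 'a \<Rightarrow> real) \<Rightarrow> (real \<Rightarrow> 'a \<Rightarrow> real) \<Rightarrow> bool" where
  "proc_le M X Y \<longleftrightarrow> (\<forall>t\<ge>0. AE \<omega> in M. X t \<omega> \<le> Y t \<omega>)"

text \<open>Processes that are modifications of each other are identified.\<close>

definition proc_eq :: "'a measure \<Rightarrow> (real \<Rightarrow> 'a \<Rightarrow> real) \<Rightarrow> (real \<Rightarrow> 'a \<Rightarrow> real) \<Rightarrow> bool" where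
  "proc_eq M X Y \<longleftrightarrow> (\<forall>t\<ge>0. AE \<omega> in M. X t \<omega> = Y t \<omega>)"

definition abs_proc :: "(real \<Rightarrow> 'a \<Rightarrow> real) \<Rightarrow> real \<Rightarrow> 'a \<Rightarrow> real" where
  "abs_proc X = (\<lambda>t \<omega>. \<bar>X t \<omega>\<bar>)"

text \<open>A partition \<open>0 = t\<^sub>0 < t\<^sub>1 < \<dots> < t\<^sub>n\<close> is encoded by \<open>n \<ge> 1\<close> and a sequence of which only
  the entries \<open>t 0, \<dots>, t n\<close> matter.\<close>

definition time_partitions :: "(nat \<times> (nat \<Rightarrow> real)) set" where
  "time_partitions = {(n, t). 1 \<le> n \<and> t 0 = 0 \<and> (\<forall>i<n. t i < t (Suc i))}"

definition Var :: "'a measure \<Rightarrow> (real \<Rightarrow> 'a measure) \<Rightarrow> (real \<Rightarrow> 'a \<Rightarrow> real) \<Rightarrow> ennreal" where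
  "Var M F X =
     (SUP (n, t) \<in> time_partitions.
        (\<Sum>i<n. \<integral>\<^sup>+ \<omega>. ennreal \<bar>X (t i) \<omega> - real_cond_exp M (F (t i)) (X (t (Suc i))) \<omega>\<bar> \<partial>M)
        + (\<integral>\<^sup>+ \<omega>. ennreal \<bar>X (t n) \<omega>\<bar> \<partial>M))"

definition quasimartingale ::
    "'a measure \<Rightarrow> (real \<Rightarrow> 'a measure) \<Rightarrow> (real \<Rightarrow> 'a \<Rightarrow> real) \<Rightarrow> bool" where
  "quasimartingale M F X \<longleftrightarrow>
     (\<forall>\<omega>\<in>space M. cadlag (\<lambda>t. X t \<omega>)) \<and>
     (\<forall>t\<ge>0. X t \<in> borel_measurable (F t)) \<and>
     (\<forall>t\<ge>0. integrable M (X t)) \<and>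
     Var M F X < \<infinity>"

end

theory Submission
  imports Defs
begin

text \<open>Along a partition put \<open>A\<^sub>i = E[X\<^sub>i\<^sub>+\<^sub>1 | F\<^sub>i] - X\<^sub>i\<close> and \<open>D\<^sub>i = E[\<bar>X\<^sub>i\<^sub>+\<^sub>1\<bar> | F\<^sub>i] - \<bar>X\<^sub>i\<bar>\<close>. The
  conditional Jensen inequality gives \<open>D\<^sub>i \<ge> -\<bar>A\<^sub>i\<bar>\<close>, hence \<open>\<bar>D\<^sub>i\<bar> \<le> D\<^sub>i + 2\<bar>A\<^sub>i\<bar>\<close>, and the
  expectations of the \<open>D\<^sub>i\<close> telescope. So \<open>\<bar>X\<bar>\<close> has variation at most \<open>2 Var X\<close>, and
  quasimartingales form a vector lattice with the pathwise operations. The Riesz decomposition is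
  then explicit: split off from \<open>X\<close> its truncation to the interval
  \<open>[-\<bar>X\<^sup>k\<bar>, \<bar>X\<^sup>k\<bar>]\<close>, and continue with the remainder, one \<open>k\<close> at a time.\<close>

section \<open>Pathwise operations on cadlag functions\<close>

lemma cadlag_add:
  assumes "cadlag f" "cadlag g"
  shows "cadlag (\<lambda>t. f t + g t)"
  using assms unfolding cadlag_def by (auto intro!: continuous_intros) (blast intro: tendsto_add)

lemma cadlag_cmult:
  assumes "cadlag f"
  shows "cadlag (\<lambda>t. c * f t)"
  using assms unfolding cadlag_def by (auto intro!: continuous_intros) (blast intro: tendsto_mult_left)

lemma cadlag_abs:
  assumes "cadlag f"
  shows "cadlag (\<lambda>t. \<bar>f t\<bar>)"
  using assms unfolding cadlag_def by (auto intro!: continuous_intros) (blast intro: tendsto_rabs)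

section \<open>Partition sums and finite variation\<close>

text \<open>The entries increase from 0. This gives access to measurability and integrability, which
  are known only at times \<open>t \<ge> 0\<close>; beyond index \<open>n\<close> the sequence is
  arbitrary.\<close>

lemma time_partitions_nonneg:
  assumes "(n, t) \<in> time_partitions" "i \<le> n"
  shows "0 \<le> t i"
  using assms(2)
proof (induction i)
  case 0
  then show ?case using assms(1) by (simp add: time_partitions_def)
next
  case (Suc i)
  then have "t i < t (Suc i)" using assms(1) by (simp add: time_partitions_def)
  then show ?case using Suc by simp
qed

text \<open>A real-valued form of the sum under the supremum in \<open>Var\<close>, so that terms
  can be subtracted and telescoped. It agrees with that sum for integrable processes; a Bochner
  integral of a non-integrable function would default to 0.\<close>

definition partition_var ::
    "'a measure \<Rightarrow> (real \<Rightarrow> 'a measure) \<Rightarrow> nat \<times> (nat \<Rightarrow> real) \<Rightarrow> (real \<Rightarrow> 'a \<Rightarrow> real) \<Rightarrow> real" where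
  "partition_var M F = (\<lambda>(n, t) X.
     (\<Sum>i<n. \<integral>\<omega>. \<bar>X (t i) \<omega> - real_cond_exp M (F (t i)) (X (t (Suc i))) \<omega>\<bar> \<partial>M)
       + (\<integral>\<omega>. \<bar>X (t n) \<omega>\<bar> \<partial>M))"

context usual_filtered_prob_space
begin

lemma sigma_finite_subalgebra_F: "0 \<le> t \<Longrightarrow> sigma_finite_subalgebra M (F t)"
  by (intro finite_measure_subalgebra_is_sigma_finite finite_measure_subalgebra.intro
      finite_measure_subalgebra_axioms.intro subalgebra_F finite_measure_axioms)

lemma Var_eq_SUP_partition_var:
  assumes X: "\<And>t. 0 \<le> t \<Longrightarrow> integrable M (X t)"
  shows "Var M F X = (SUP p \<in> time_partitions. ennreal (partition_var M F p X))"
  unfolding Var_def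
proof (rule SUP_cong[OF refl], clarify)
  fix n t assume p: "(n, t) \<in> time_partitions"
  note nonneg = time_partitions_nonneg[OF p]
  have int: "integrable M (\<lambda>\<omega>. \<bar>X (t i) \<omega> - real_cond_exp M (F (t i)) (X (t (Suc i))) \<omega>\<bar>)"
    if "i < n" for i
    using that nonneg[of i] nonneg[of "Suc i"] X
    by (intro integrable_abs Bochner_Integration.integrable_diff
        sigma_finite_subalgebra.real_cond_exp_int(1) sigma_finite_subalgebra_F) auto
  have sum: "(\<Sum>i<n. \<integral>\<^sup>+ \<omega>. ennreal \<bar>X (t i) \<omega> - real_cond_exp M (F (t i)) (X (t (Suc i))) \<omega>\<bar> \<partial>M)
     = ennreal (\<Sum>i<n. \<integral>\<omega>. \<bar>X (t i) \<omega> - real_cond_exp M (F (t i)) (X (t (Suc i))) \<omega>\<bar> \<partial>M)"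
    using int by (simp add: nn_integral_eq_integral flip: sum_ennreal)
  have last: "(\<integral>\<^sup>+ \<omega>. ennreal \<bar>X (t n) \<omega>\<bar> \<partial>M) = ennreal (\<integral>\<omega>. \<bar>X (t n) \<omega>\<bar> \<partial>M)"
    using X nonneg by (intro nn_integral_eq_integral) auto
  show "(\<Sum>i<n. \<integral>\<^sup>+ \<omega>. ennreal \<bar>X (t i) \<omega> - real_cond_exp M (F (t i)) (X (t (Suc i))) \<omega>\<bar> \<partial>M)
        + (\<integral>\<^sup>+ \<omega>. ennreal \<bar>X (t n) \<omega>\<bar> \<partial>M) = ennreal (partition_var M F (n, t) X)"
    unfolding sum last partition_var_def by (simp add: sum_nonneg ennreal_plus)
qed

text \<open>Reduces finiteness of an extended-real supremum to one real bound for all partitions, so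
  that an inequality proved on each partition separately carries over to quasimartingales.\<close>

lemma Var_finite_iff:
  assumes "\<And>t. 0 \<le> t \<Longrightarrow> integrable M (X t)"
  shows "Var M F X < \<infinity> \<longleftrightarrow> (\<exists>C. \<forall>p \<in> time_partitions. partition_var M F p X \<le> C)"
proof
  assume fin: "Var M F X < \<infinity>"
  have "partition_var M F p X \<le> enn2real (Var M F X)" if "p \<in> time_partitions" for p
  proof -
    have "ennreal (partition_var M F p X) \<le> Var M F X"
      using that by (auto simp: Var_eq_SUP_partition_var[of X, OF assms] intro!: SUP_upper2[of p])
    then show ?thesis
      using fin by (metis ennreal_le_iff enn2real_nonneg ennreal_enn2real infinity_ennreal_def)
  qed
  then show "\<exists>C. \<forall>p \<in> time_partitions. partition_var M F p X \<le> C" by blast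
next
  assume "\<exists>C. \<forall>p \<in> time_partitions. partition_var M F p X \<le> C"
  then obtain C where C: "\<And>p. p \<in> time_partitions \<Longrightarrow> partition_var M F p X \<le> C" by blast
  have "Var M F X \<le> ennreal C"
    by (auto simp: Var_eq_SUP_partition_var[of X, OF assms] intro!: SUP_least ennreal_leI C)
  then show "Var M F X < \<infinity>"
    by (simp add: le_less_trans)
qed

section \<open>Estimates along a fixed partition\<close>

text \<open>Scaling and subadditivity come from linearity of conditional expectation and the
  triangle inequality. The bound for the absolute value rests on conditional Jensen and
  telescoping.\<close>

lemma
  assumes X: "\<And>t. 0 \<le> t \<Longrightarrow> integrable M (X t)" and p: "p \<in> time_partitions"
  shows partition_var_cmult:
      "partition_var M F p (\<lambda>t \<omega>. c * X t \<omega>) = \<bar>c\<bar> * partition_var M F p X"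
    and partition_var_abs: "partition_var M F p (\<lambda>t \<omega>. \<bar>X t \<omega>\<bar>) \<le> 2 * partition_var M F p X"
    and partition_var_add: "(\<And>t. 0 \<le> t \<Longrightarrow> integrable M (Y t)) \<Longrightarrow>
      partition_var M F p (\<lambda>t \<omega>. X t \<omega> + Y t \<omega>) \<le> partition_var M F p X + partition_var M F p Y"
proof -
  obtain n t where nt: "p = (n, t)" by (cases p)
  note nonneg = time_partitions_nonneg[OF p[unfolded nt]]
  define G where "G i = F (t i)" for i
  \<comment> \<open>In the notation of the introduction \<open>\<Delta> X i\<close> is
    \<open>-A\<^sub>i\<close>, and \<open>\<Delta>\<close> of the absolute value process is
    \<open>-D\<^sub>i\<close>.\<close>
  define \<Delta> where "\<Delta> Z i \<omega> = Z (t i) \<omega> - real_cond_exp M (G i) (Z (t (Suc i))) \<omega>"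
    for Z :: "real \<Rightarrow> 'a \<Rightarrow> real" and i \<omega>
  have pv: "partition_var M F p Z = (\<Sum>i<n. \<integral>\<omega>. \<bar>\<Delta> Z i \<omega>\<bar> \<partial>M) + (\<integral>\<omega>. \<bar>Z (t n) \<omega>\<bar> \<partial>M)" for Z
    by (simp add: partition_var_def nt \<Delta>_def G_def)
  have sfs: "sigma_finite_subalgebra M (G i)" if "i < n" for i
    unfolding G_def using that nonneg by (intro sigma_finite_subalgebra_F) auto
  have ce_int: "integrable M (real_cond_exp M (G i) (Z (t (Suc i))))"
    "(\<integral>\<omega>. real_cond_exp M (G i) (Z (t (Suc i))) \<omega> \<partial>M) = (\<integral>\<omega>. Z (t (Suc i)) \<omega> \<partial>M)"
    if "\<And>t. 0 \<le> t \<Longrightarrow> integrable M (Z t)" "i < n" for Z i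
    using that nonneg[of "Suc i"]
    by (auto intro!: sigma_finite_subalgebra.real_cond_exp_int sfs)
  have \<Delta>_int: "integrable M (\<Delta> Z i)"
    if "\<And>t. 0 \<le> t \<Longrightarrow> integrable M (Z t)" "i < n" for Z i
    unfolding \<Delta>_def using that nonneg[of i] ce_int[of Z i]
    by (intro Bochner_Integration.integrable_diff) auto

  show "partition_var M F p (\<lambda>t \<omega>. c * X t \<omega>) = \<bar>c\<bar> * partition_var M F p X"
  proof -
    have "(\<integral>\<omega>. \<bar>\<Delta> (\<lambda>t \<omega>. c * X t \<omega>) i \<omega>\<bar> \<partial>M) = \<bar>c\<bar> * (\<integral>\<omega>. \<bar>\<Delta> X i \<omega>\<bar> \<partial>M)" if "i < n" for i
    proof -
      have int: "integrable M (X (t (Suc i)))" using X nonneg[of "Suc i"] that by auto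
      have "AE \<omega> in M. \<bar>\<Delta> (\<lambda>t \<omega>. c * X t \<omega>) i \<omega>\<bar> = \<bar>c\<bar> * \<bar>\<Delta> X i \<omega>\<bar>"
        using sigma_finite_subalgebra.real_cond_exp_cmult[OF sfs[OF that] int, of c]
      proof eventually_elim
        case (elim \<omega>)
        have "\<Delta> (\<lambda>t \<omega>. c * X t \<omega>) i \<omega> = c * \<Delta> X i \<omega>"
          using elim by (simp add: \<Delta>_def right_diff_distrib)
        then show ?case by (simp add: abs_mult)
      qed
      moreover have "integrable M (\<Delta> (\<lambda>t \<omega>. c * X t \<omega>) i)"
        using X that by (intro \<Delta>_int) auto
      ultimately have "(\<integral>\<omega>. \<bar>\<Delta> (\<lambda>t \<omega>. c * X t \<omega>) i \<omega>\<bar> \<partial>M) = (\<integral>\<omega>. \<bar>c\<bar> * \<bar>\<Delta> X i \<omega>\<bar> \<partial>M)"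
        using \<Delta>_int[OF X that] by (intro integral_cong_AE) auto
      then show ?thesis by simp
    qed
    then show ?thesis
      by (simp add: pv abs_mult sum_distrib_left distrib_left)
  qed

  show "partition_var M F p (\<lambda>t \<omega>. X t \<omega> + Y t \<omega>) \<le> partition_var M F p X + partition_var M F p Y"
    if Y: "\<And>t. 0 \<le> t \<Longrightarrow> integrable M (Y t)"
  proof -
    have "(\<integral>\<omega>. \<bar>\<Delta> (\<lambda>t \<omega>. X t \<omega> + Y t \<omega>) i \<omega>\<bar> \<partial>M) \<le> (\<integral>\<omega>. \<bar>\<Delta> X i \<omega>\<bar> \<partial>M) + (\<integral>\<omega>. \<bar>\<Delta> Y i \<omega>\<bar> \<partial>M)"
      if "i < n" for i
    proof -
      have int: "integrable M (X (t (Suc i)))" "integrable M (Y (t (Suc i)))"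
        using X Y nonneg[of "Suc i"] that by auto
      have "AE \<omega> in M. \<bar>\<Delta> (\<lambda>t \<omega>. X t \<omega> + Y t \<omega>) i \<omega>\<bar> \<le> \<bar>\<Delta> X i \<omega>\<bar> + \<bar>\<Delta> Y i \<omega>\<bar>"
        using sigma_finite_subalgebra.real_cond_exp_add[OF sfs[OF that] int]
        by eventually_elim (simp add: \<Delta>_def)
      moreover have "integrable M (\<Delta> (\<lambda>t \<omega>. X t \<omega> + Y t \<omega>) i)"
        using X Y that by (intro \<Delta>_int) auto
      ultimately have "(\<integral>\<omega>. \<bar>\<Delta> (\<lambda>t \<omega>. X t \<omega> + Y t \<omega>) i \<omega>\<bar> \<partial>M)
          \<le> (\<integral>\<omega>. \<bar>\<Delta> X i \<omega>\<bar> + \<bar>\<Delta> Y i \<omega>\<bar> \<partial>M)"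
        using \<Delta>_int[OF X that] \<Delta>_int[OF Y that] by (intro integral_mono_AE) auto
      also have "\<dots> = (\<integral>\<omega>. \<bar>\<Delta> X i \<omega>\<bar> \<partial>M) + (\<integral>\<omega>. \<bar>\<Delta> Y i \<omega>\<bar> \<partial>M)"
        using \<Delta>_int[OF X that] \<Delta>_int[OF Y that] by (intro Bochner_Integration.integral_add) auto
      finally show ?thesis .
    qed
    then have "(\<Sum>i<n. \<integral>\<omega>. \<bar>\<Delta> (\<lambda>t \<omega>. X t \<omega> + Y t \<omega>) i \<omega>\<bar> \<partial>M)
        \<le> (\<Sum>i<n. \<integral>\<omega>. \<bar>\<Delta> X i \<omega>\<bar> \<partial>M) + (\<Sum>i<n. \<integral>\<omega>. \<bar>\<Delta> Y i \<omega>\<bar> \<partial>M)"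
      unfolding sum.distrib[symmetric] by (intro sum_mono) auto
    moreover have "(\<integral>\<omega>. \<bar>X (t n) \<omega> + Y (t n) \<omega>\<bar> \<partial>M)
        \<le> (\<integral>\<omega>. \<bar>X (t n) \<omega>\<bar> \<partial>M) + (\<integral>\<omega>. \<bar>Y (t n) \<omega>\<bar> \<partial>M)"
      using X[of "t n"] Y[of "t n"] nonneg[of n]
      by (simp add: integral_mono abs_triangle_ineq flip: Bochner_Integration.integral_add)
    ultimately show ?thesis by (simp add: pv)
  qed

  show "partition_var M F p (\<lambda>t \<omega>. \<bar>X t \<omega>\<bar>) \<le> 2 * partition_var M F p X"
  proof -
    let ?A = "\<lambda>t \<omega>. \<bar>X t \<omega>\<bar>"
    have A: "\<And>t. 0 \<le> t \<Longrightarrow> integrable M (?A t)" using X by auto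
    have "(\<integral>\<omega>. \<bar>\<Delta> ?A i \<omega>\<bar> \<partial>M) \<le> 2 * (\<integral>\<omega>. \<bar>\<Delta> X i \<omega>\<bar> \<partial>M)
        + ((\<integral>\<omega>. ?A (t (Suc i)) \<omega> \<partial>M) - (\<integral>\<omega>. ?A (t i) \<omega> \<partial>M))" if "i < n" for i
    proof -
      \<comment> \<open>Used with \<open>x\<close> the present value, \<open>c\<close> the
        conditional expectation of the next value and \<open>e\<close> that of its absolute value.
        Since \<bar>c\<bar> \<le> e, one has \<bar>x\<bar> - e \<le> \<bar>x - c\<bar>. This settles
        the case \<bar>x\<bar> \<ge> e; otherwise the two sides differ by the nonnegative term
        2\<bar>x - c\<bar>.\<close>
      have key: "\<bar>\<bar>x\<bar> - e\<bar> \<le> 2 * \<bar>x - c\<bar> - (\<bar>x\<bar> - e)" if "c \<le> e" "- c \<le> e" for x c e :: real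
        using that by (simp add: abs_if)
      have int: "integrable M (X (t i))" "integrable M (X (t (Suc i)))" "integrable M (?A (t (Suc i)))"
        using X A nonneg[of i] nonneg[of "Suc i"] that by auto
      \<comment> \<open>Conditional Jensen for the absolute value follows from monotonicity, applied
        to the next value and to its negative, both at most its absolute value.\<close>
      have "AE \<omega> in M. real_cond_exp M (G i) (\<lambda>\<omega>. - X (t (Suc i)) \<omega>) \<omega>
          = - real_cond_exp M (G i) (X (t (Suc i))) \<omega>"
        using sigma_finite_subalgebra.real_cond_exp_cmult[OF sfs[OF that] int(2), of "-1"] by simp
      moreover have "AE \<omega> in M. real_cond_exp M (G i) (X (t (Suc i))) \<omega>
          \<le> real_cond_exp M (G i) (?A (t (Suc i))) \<omega>"
        using int by (intro sigma_finite_subalgebra.real_cond_exp_mono[OF sfs[OF that]]) auto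
      moreover have "AE \<omega> in M. real_cond_exp M (G i) (\<lambda>\<omega>. - X (t (Suc i)) \<omega>) \<omega>
          \<le> real_cond_exp M (G i) (?A (t (Suc i))) \<omega>"
        using int by (intro sigma_finite_subalgebra.real_cond_exp_mono[OF sfs[OF that]]) auto
      ultimately have "AE \<omega> in M. \<bar>\<Delta> ?A i \<omega>\<bar> \<le> 2 * \<bar>\<Delta> X i \<omega>\<bar> - \<Delta> ?A i \<omega>"
        unfolding \<Delta>_def by eventually_elim (rule key, auto)
      then have "(\<integral>\<omega>. \<bar>\<Delta> ?A i \<omega>\<bar> \<partial>M) \<le> (\<integral>\<omega>. 2 * \<bar>\<Delta> X i \<omega>\<bar> - \<Delta> ?A i \<omega> \<partial>M)"
        using \<Delta>_int[OF X that] \<Delta>_int[OF A that] by (intro integral_mono_AE) auto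
      also have "\<dots> = 2 * (\<integral>\<omega>. \<bar>\<Delta> X i \<omega>\<bar> \<partial>M) - (\<integral>\<omega>. \<Delta> ?A i \<omega> \<partial>M)"
        using \<Delta>_int[OF X that] \<Delta>_int[OF A that]
        by (subst Bochner_Integration.integral_diff) auto
      \<comment> \<open>A conditional expectation has the same mean as the variable itself, so only
        differences of successive means remain.\<close>
      also have "(\<integral>\<omega>. \<Delta> ?A i \<omega> \<partial>M) = (\<integral>\<omega>. ?A (t i) \<omega> \<partial>M) - (\<integral>\<omega>. ?A (t (Suc i)) \<omega> \<partial>M)"
        unfolding \<Delta>_def using int ce_int[of ?A, OF A that]
        by (subst Bochner_Integration.integral_diff) auto
      finally show ?thesis by simp
    qed
    then have "(\<Sum>i<n. \<integral>\<omega>. \<bar>\<Delta> ?A i \<omega>\<bar> \<partial>M) \<le> (\<Sum>i<n. 2 * (\<integral>\<omega>. \<bar>\<Delta> X i \<omega>\<bar> \<partial>M)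
        + ((\<integral>\<omega>. ?A (t (Suc i)) \<omega> \<partial>M) - (\<integral>\<omega>. ?A (t i) \<omega> \<partial>M)))"
      by (intro sum_mono) auto
    also have "\<dots> = 2 * (\<Sum>i<n. \<integral>\<omega>. \<bar>\<Delta> X i \<omega>\<bar> \<partial>M)
        + ((\<integral>\<omega>. ?A (t n) \<omega> \<partial>M) - (\<integral>\<omega>. ?A (t 0) \<omega> \<partial>M))"
      by (simp add: sum.distrib sum_distrib_left[symmetric]
          sum_lessThan_telescope[of "\<lambda>i. \<integral>\<omega>. ?A (t i) \<omega> \<partial>M"])
    \<comment> \<open>The mean at time 0 enters negatively and is dropped. The mean left over at
      \<open>t n\<close> joins the terminal term of the partition sum, giving it the factor 2 as
      well.\<close>
    also have "\<dots> \<le> 2 * (\<Sum>i<n. \<integral>\<omega>. \<bar>\<Delta> X i \<omega>\<bar> \<partial>M) + (\<integral>\<omega>. ?A (t n) \<omega> \<partial>M)"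
      by simp
    finally show ?thesis by (simp add: pv)
  qed
qed

section \<open>Quasimartingales as a vector lattice\<close>

lemma quasimartingale_iff:
  "quasimartingale M F X \<longleftrightarrow>
     (\<forall>\<omega>\<in>space M. cadlag (\<lambda>t. X t \<omega>)) \<and>
     (\<forall>t\<ge>0. X t \<in> borel_measurable (F t)) \<and>
     (\<forall>t\<ge>0. integrable M (X t)) \<and>
     (\<exists>C. \<forall>p \<in> time_partitions. partition_var M F p X \<le> C)"
  unfolding quasimartingale_def using Var_finite_iff by blast

lemma quasimartingale_add:
  assumes "quasimartingale M F X" "quasimartingale M F Y"
  shows "quasimartingale M F (\<lambda>t \<omega>. X t \<omega> + Y t \<omega>)"
proof -
  obtain C D where "\<forall>p \<in> time_partitions. partition_var M F p X \<le> C"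
    "\<forall>p \<in> time_partitions. partition_var M F p Y \<le> D"
    using assms unfolding quasimartingale_iff by blast
  then have "\<forall>p \<in> time_partitions. partition_var M F p (\<lambda>t \<omega>. X t \<omega> + Y t \<omega>) \<le> C + D"
    using assms unfolding quasimartingale_iff
    by (intro ballI order_trans[OF partition_var_add] add_mono) auto
  then show ?thesis
    using assms unfolding quasimartingale_iff by (auto intro: cadlag_add borel_measurable_add)
qed

lemma quasimartingale_cmult:
  assumes "quasimartingale M F X"
  shows "quasimartingale M F (\<lambda>t \<omega>. c * X t \<omega>)"
proof -
  obtain C where "\<forall>p \<in> time_partitions. partition_var M F p X \<le> C"
    using assms unfolding quasimartingale_iff by blast
  then have "\<forall>p \<in> time_partitions. partition_var M F p (\<lambda>t \<omega>. c * X t \<omega>) \<le> \<bar>c\<bar> * C"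
    using assms unfolding quasimartingale_iff
    by (auto simp: partition_var_cmult intro!: mult_left_mono)
  then show ?thesis
    using assms unfolding quasimartingale_iff by (auto intro: cadlag_cmult)
qed

lemma quasimartingale_diff:
  assumes "quasimartingale M F X" "quasimartingale M F Y"
  shows "quasimartingale M F (\<lambda>t \<omega>. X t \<omega> - Y t \<omega>)"
  using quasimartingale_add[OF assms(1) quasimartingale_cmult[OF assms(2), of "-1"]] by simp

lemma quasimartingale_abs:
  assumes "quasimartingale M F X"
  shows "quasimartingale M F (\<lambda>t \<omega>. \<bar>X t \<omega>\<bar>)"
proof -
  obtain C where "\<forall>p \<in> time_partitions. partition_var M F p X \<le> C"
    using assms unfolding quasimartingale_iff by blast
  then have "\<forall>p \<in> time_partitions. partition_var M F p (\<lambda>t \<omega>. \<bar>X t \<omega>\<bar>) \<le> 2 * C"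
    using assms unfolding quasimartingale_iff
    by (intro ballI order_trans[OF partition_var_abs] mult_left_mono) auto
  then show ?thesis
    using assms unfolding quasimartingale_iff by (auto intro: cadlag_abs)
qed

section \<open>Riesz decomposition by successive truncation\<close>

text \<open>For \<open>a \<ge> 0\<close>, the truncation of \<open>x\<close> to \<open>[-a, a]\<close> equals \<open>(\<bar>x + a\<bar> - \<bar>x - a\<bar>) / 2\<close>.\<close>

lemma quasimartingale_Riesz_decomposition:
  assumes "finite I" "quasimartingale M F X" "\<And>k. k \<in> I \<Longrightarrow> quasimartingale M F (Xs k)"
    and "proc_le M (abs_proc X) (\<lambda>t \<omega>. \<Sum>k\<in>I. \<bar>Xs k t \<omega>\<bar>)"
  shows "\<exists>Y. (\<forall>k\<in>I. quasimartingale M F (Y k) \<and> proc_le M (abs_proc (Y k)) (abs_proc (Xs k)) \<and>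
                (proc_le M (\<lambda>t \<omega>. 0) X \<longrightarrow> proc_le M (\<lambda>t \<omega>. 0) (Y k))) \<and>
             proc_eq M X (\<lambda>t \<omega>. \<Sum>k\<in>I. Y k t \<omega>)"
  using assms
\<comment> \<open>\<open>X\<close> is arbitrary because the induction hypothesis is applied to the
  remainder. A bound by the sum of the absolute values is the form that the remainder inherits, with
  one summand fewer.\<close>
proof (induction I arbitrary: X rule: finite_induct)
  case empty
  then show ?case by (simp add: proc_le_def proc_eq_def abs_proc_def)
next
  case (insert j I)
  \<comment> \<open>Truncation of \<open>X\<close> at level \<bar>Xs j\<bar>, written with lattice
    operations only, so that the closure lemmas show it to be a quasimartingale.\<close>
  define T where "T t \<omega> = (1/2) * (\<bar>X t \<omega> + \<bar>Xs j t \<omega>\<bar>\<bar> - \<bar>X t \<omega> - \<bar>Xs j t \<omega>\<bar>\<bar>)" for t \<omega>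
  define R where "R t \<omega> = X t \<omega> - T t \<omega>" for t \<omega>
  have Xj: "quasimartingale M F (Xs j)" using insert.prems by simp
  have T: "quasimartingale M F T"
    unfolding T_def
    by (intro quasimartingale_cmult quasimartingale_diff quasimartingale_abs quasimartingale_add
        insert.prems(1) Xj)
  have R: "quasimartingale M F R"
    unfolding R_def by (intro quasimartingale_diff insert.prems(1) T)
  have T_le: "proc_le M (abs_proc T) (abs_proc (Xs j))"
    by (simp add: proc_le_def abs_proc_def T_def)
  \<comment> \<open>For x \<ge> 0 and level a \<ge> 0 the truncation is min x a and the remainder is
    max (x - a) 0.\<close>
  have pos: "proc_le M (\<lambda>t \<omega>. 0) T \<and> proc_le M (\<lambda>t \<omega>. 0) R" if "proc_le M (\<lambda>t \<omega>. 0) X"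
    using that unfolding proc_le_def
    by (auto simp: T_def R_def elim!: eventually_mono)
  have R_le: "proc_le M (abs_proc R) (\<lambda>t \<omega>. \<Sum>k\<in>I. \<bar>Xs k t \<omega>\<bar>)"
    unfolding proc_le_def abs_proc_def
  proof (intro allI impI)
    fix t :: real assume "0 \<le> t"
    then have "AE \<omega> in M. \<bar>X t \<omega>\<bar> \<le> \<bar>Xs j t \<omega>\<bar> + (\<Sum>k\<in>I. \<bar>Xs k t \<omega>\<bar>)"
      using insert.prems(3) insert.hyps by (simp add: proc_le_def abs_proc_def)
    then show "AE \<omega> in M. \<bar>R t \<omega>\<bar> \<le> (\<Sum>k\<in>I. \<bar>Xs k t \<omega>\<bar>)"
    proof eventually_elim
      case (elim \<omega>)
      \<comment> \<open>With level a, the remainder has absolute value max (\<bar>x\<bar> - a) 0.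
        Nonnegativity of the sum covers the case \<bar>x\<bar> \<le> a, where the remainder
        vanishes.\<close>
      have "0 \<le> (\<Sum>k\<in>I. \<bar>Xs k t \<omega>\<bar>)" by (intro sum_nonneg) simp
      then show ?case using elim by (simp add: R_def T_def abs_if split: if_splits)
    qed
  qed
  obtain Y where Y: "\<forall>k\<in>I. quasimartingale M F (Y k) \<and> proc_le M (abs_proc (Y k)) (abs_proc (Xs k)) \<and>
        (proc_le M (\<lambda>t \<omega>. 0) R \<longrightarrow> proc_le M (\<lambda>t \<omega>. 0) (Y k))"
      and sum: "proc_eq M R (\<lambda>t \<omega>. \<Sum>k\<in>I. Y k t \<omega>)"
    using insert.IH[OF R _ R_le] insert.prems(2) by auto
  \<comment> \<open>As \<open>j\<close> lies outside \<open>I\<close>, the update leaves the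
    components on \<open>I\<close> unchanged.\<close>
  have "proc_eq M X (\<lambda>t \<omega>. \<Sum>k\<in>insert j I. (Y(j := T)) k t \<omega>)"
  proof -
    have "(\<Sum>k\<in>insert j I. (Y(j := T)) k t \<omega>) = T t \<omega> + (\<Sum>k\<in>I. Y k t \<omega>)" for t \<omega>
      using insert.hyps by (auto intro!: sum.cong)
    then show ?thesis
      using sum by (simp add: proc_eq_def R_def algebra_simps)
  qed
  moreover have "\<forall>k\<in>insert j I. quasimartingale M F ((Y(j := T)) k) \<and>
      proc_le M (abs_proc ((Y(j := T)) k)) (abs_proc (Xs k)) \<and>
      (proc_le M (\<lambda>t \<omega>. 0) X \<longrightarrow> proc_le M (\<lambda>t \<omega>. 0) ((Y(j := T)) k))"
    using Y T T_le pos by auto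
  ultimately show ?case by blast
qed

end

theorem corollary3p3:
  fixes M :: "'a measure" and F :: "real \<Rightarrow> 'a measure"
    and n :: nat
    and X :: "real \<Rightarrow> 'a \<Rightarrow> real" and Xs :: "nat \<Rightarrow> real \<Rightarrow> 'a \<Rightarrow> real"
  assumes "usual_filtered_prob_space M F"
    and "n \<ge> 1"
    and "quasimartingale M F X"
    and "\<And>k. k \<in> {1..n} \<Longrightarrow> quasimartingale M F (Xs k)"
    and "proc_le M (abs_proc X) (abs_proc (\<lambda>t \<omega>. \<Sum>k=1..n. Xs k t \<omega>))"
  shows "(\<exists>Y :: nat \<Rightarrow> real \<Rightarrow> 'a \<Rightarrow> real.
            (\<forall>k\<in>{1..n}. quasimartingale M F (Y k) \<and> proc_le M (abs_proc (Y k)) (abs_proc (Xs k))) \<and>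
            proc_eq M X (\<lambda>t \<omega>. \<Sum>k=1..n. Y k t \<omega>)) \<and>
         (proc_le M (\<lambda>t \<omega>. 0) X \<longrightarrow>
          (\<exists>Y :: nat \<Rightarrow> real \<Rightarrow> 'a \<Rightarrow> real.
            (\<forall>k\<in>{1..n}. quasimartingale M F (Y k) \<and> proc_le M (abs_proc (Y k)) (abs_proc (Xs k)) \<and>
                         proc_le M (\<lambda>t \<omega>. 0) (Y k)) \<and>
            proc_eq M X (\<lambda>t \<omega>. \<Sum>k=1..n. Y k t \<omega>)))"
proof -
  interpret usual_filtered_prob_space M F by fact
  \<comment> \<open>The triangle inequality passes to the weaker bound that suits the
    induction.\<close>
  have "proc_le M (abs_proc X) (\<lambda>t \<omega>. \<Sum>k\<in>{1..n}. \<bar>Xs k t \<omega>\<bar>)"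
    unfolding proc_le_def abs_proc_def
  proof (intro allI impI)
    fix t :: real assume "0 \<le> t"
    then have "AE \<omega> in M. \<bar>X t \<omega>\<bar> \<le> \<bar>\<Sum>k=1..n. Xs k t \<omega>\<bar>"
      using assms(5) by (simp add: proc_le_def abs_proc_def)
    then show "AE \<omega> in M. \<bar>X t \<omega>\<bar> \<le> (\<Sum>k\<in>{1..n}. \<bar>Xs k t \<omega>\<bar>)"
      by eventually_elim (rule order_trans[OF _ sum_abs])
  qed
  \<comment> \<open>The same \<open>Y\<close> serves both claims, since its components are
    nonnegative whenever \<open>X\<close> is.\<close>
  from quasimartingale_Riesz_decomposition[OF finite_atLeastAtMost assms(3,4) this]
  show ?thesis by blast
qed

end
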